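(* Let $p$ be a permutation pattern, with inverse permutation $p^{-1}$. Then for all integers $n\ge k\ge 1$, $$\mathrm{op}_{n,k}(p)=\sum_{j=1}^{k}\binom{k}{j}(-1)^{k-j}\,\bigl|[j]^n(p^{-1})\bigr|.$$
   Context: $[n]=\{1,\dots,n\}$. A permutation pattern is a permutation $p=p_1p_2\cdots p_m\in\mathfrak S_m$ of $[m]$ for some $m\ge 1$. An ordered partition of $[n]$ into $k$ blocks is a sequence $\pi=B_1/B_2/\cdots/B_k$ of nonempty pairwise disjoint subsets with union $[n]$. Such $\pi$ contains $p=p_1\cdots p_m$ if there exist integers $1\le i_1<i_2<\cdots<i_m\le k$ and elements $b_j\in B_{i_j}$ ($1\le j\le m$) such that the sequence $b_1b_2\cdots b_m$ is order isomorphic to $p$ (i.e. $b_s<b_t\iff p_s<p_t$); otherwise $\pi$ avoids $p$. $\mathrm{op}_{n,k}(p)$ is the number of ordered partitions of $[n]$ into $k$ blocks that avoid $p$. For a permutation $q\in\mathfrak S_m$, a word $w=w_1\cdots w_n$ with positive integer letters contains $q$ if there are indices $1\le i_1<\cdots<i_m\le n$ such that $w_{i_1}\cdots w_{i_m}$ is order isomorphic to $q$ (in particular these letters are distinct); otherwise $w$ avoids $q$. $[j]^n(q)$ denotes the set of words of length $n$ with letters in $[j]$ that avoid $q$. *)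

theory Defs
  imports "HOL-Combinatorics.Permutations" "HOL-Library.Disjoint_Sets"
begin

text \<open>
  A permutation of \<open>[m]\<close> is a function \<open>p\<close> with \<open>p permutes {1..m}\<close>; it is turned into the list
  \<open>p\<^sub>1 p\<^sub>2 \<dots> p\<^sub>m\<close> by \<open>one_line\<close>. List positions are counted from \<open>0\<close>, so all index sets below
  are \<open>{..<m}\<close>, while the letters and the elements of blocks start at \<open>1\<close>.
\<close>

definition one_line :: "nat \<Rightarrow> (nat \<Rightarrow> nat) \<Rightarrow> nat list" where
  "one_line m p = map p [1..<Suc m]"

definition order_isomorphic :: "nat list \<Rightarrow> nat list \<Rightarrow> bool" where
  "order_isomorphic u v \<longleftrightarrow>
     length u = length v \<and>
     (\<forall>s<length v. \<forall>t<length v. u ! s < u ! t \<longleftrightarrow> v ! s < v ! t)"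

definition ordered_partitions :: "nat \<Rightarrow> nat \<Rightarrow> nat set list set" where
  "ordered_partitions n k =
     {\<pi>. length \<pi> = k \<and> (\<forall>B\<in>set \<pi>. B \<noteq> {}) \<and>
         disjoint_family_on (\<lambda>i. \<pi> ! i) {..<k} \<and> \<Union>(set \<pi>) = {1..n}}"

definition partition_contains :: "nat set list \<Rightarrow> nat list \<Rightarrow> bool" where
  "partition_contains \<pi> p \<longleftrightarrow>
     (\<exists>i b. strict_mono_on {..<length p} i \<and>
            (\<forall>j<length p. i j < length \<pi> \<and> b j \<in> \<pi> ! i j) \<and>
            order_isomorphic (map b [0..<length p]) p)"

definition op_count :: "nat \<Rightarrow> nat \<Rightarrow> nat list \<Rightarrow> nat" where
  "op_count n k p = card {\<pi> \<in> ordered_partitions n k. \<not> partition_contains \<pi> p}"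

definition word_contains :: "nat list \<Rightarrow> nat list \<Rightarrow> bool" where
  "word_contains w q \<longleftrightarrow>
     (\<exists>i. strict_mono_on {..<length q} i \<and>
          (\<forall>j<length q. i j < length w) \<and>
          order_isomorphic (map (\<lambda>j. w ! i j) [0..<length q]) q)"

definition avoiding_words :: "nat \<Rightarrow> nat \<Rightarrow> nat list \<Rightarrow> nat list set" where
  "avoiding_words j n q = {w. length w = n \<and> set w \<subseteq> {1..j} \<and> \<not> word_contains w q}"

end

theory Submission
  imports Defs "HOL-Library.Infinite_Set"
begin

text \<open>
  Recording, for each element of \<open>[n]\<close>, the number of the block that contains it turns an ordered
  partition of \<open>[n]\<close> into \<open>k\<close> blocks into a word of length \<open>n\<close> whose set of letters is exactly
  \<open>[k]\<close>, and every such word arises once (\<open>bij_betw_blocks_of_word\<close>). An occurrence of a pattern is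
  a set of pairs (block number, element); the partition reads these pairs by increasing block
  number, the word reads them by increasing element. Exchanging the two coordinates inverts the
  pattern (\<open>occurrence_transpose\<close>), so the partition contains \<open>p\<close> if and only if the word contains
  the inverse of \<open>p\<close>, and \<open>op_count n k p\<close> counts the words with letter set exactly \<open>[k]\<close> that
  avoid the inverse of \<open>p\<close>.

  Words with letters in a set \<open>A\<close> split according to their actual letter set \<open>T \<subseteq> A\<close>, so Moebius
  inversion over the subsets of \<open>[k]\<close> expresses the words that use all of \<open>[k]\<close> through the words
  that use letters of \<open>T\<close> only. As containment depends only on the relative order of the letters,
  the number of the latter depends only on the size of \<open>T\<close> (\<open>card_avoiding_words_over\<close>), and
  grouping the subsets by size produces the binomial coefficients.
\<close>

section \<open>Patterns and inverse patterns\<close>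

lemma length_one_line [simp]: "length (one_line m p) = m"
  by (simp add: one_line_def)

lemma order_isomorphic_one_line_iff:
  "order_isomorphic (map b [0..<m]) (one_line m p) \<longleftrightarrow>
     (\<forall>s<m. \<forall>t<m. b s < b t \<longleftrightarrow> p (Suc s) < p (Suc t))"
  by (simp add: order_isomorphic_def one_line_def del: upt_Suc)

text \<open>
  Listing the points \<open>(i j, b j)\<close> by increasing second instead of first coordinate transposes the
  permutation matrix of the pattern. The relation \<open>R\<close> stands for any condition on the points, such
  as lying on the graph of a word or in the blocks of a partition.
\<close>

lemma occurrence_transpose:
  assumes p: "p permutes {1..m}"
    and i: "strict_mono_on {..<m} i"
    and b: "order_isomorphic (map b [0..<m]) (one_line m p)"
    and R: "\<forall>j<m. R (i j) (b j)"
  shows "\<exists>c v. strict_mono_on {..<m} c \<and>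
           order_isomorphic (map v [0..<m]) (one_line m (inv p)) \<and> (\<forall>j<m. R (v j) (c j))"
proof -
  define \<sigma> where "\<sigma> j = inv p (Suc j) - 1" for j
  have \<sigma>: "\<sigma> j < m \<and> Suc (\<sigma> j) = inv p (Suc j) \<and> p (Suc (\<sigma> j)) = Suc j" if "j < m" for j
  proof -
    have "inv p (Suc j) \<in> {1..m}"
      using permutes_in_image[OF permutes_inv[OF p]] that by auto
    moreover from this have "Suc (\<sigma> j) = inv p (Suc j)"
      by (simp add: \<sigma>_def)
    ultimately show ?thesis
      using permutes_inverses(1)[OF p] by auto
  qed
  have "strict_mono_on {..<m} (\<lambda>j. b (\<sigma> j))"
  proof (rule strict_mono_onI)
    fix s t assume "s \<in> {..<m}" "t \<in> {..<m}" "s < t"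
    then show "b (\<sigma> s) < b (\<sigma> t)"
      using b \<sigma>[of s] \<sigma>[of t] unfolding order_isomorphic_one_line_iff
      by (metis Suc_less_eq lessThan_iff)
  qed
  moreover have "order_isomorphic (map (\<lambda>j. i (\<sigma> j)) [0..<m]) (one_line m (inv p))"
    unfolding order_isomorphic_one_line_iff
  proof (intro allI impI)
    fix s t assume "s < m" "t < m"
    then show "i (\<sigma> s) < i (\<sigma> t) \<longleftrightarrow> inv p (Suc s) < inv p (Suc t)"
      using \<sigma>[of s] \<sigma>[of t] strict_mono_on_less[OF i, of "\<sigma> s" "\<sigma> t"]
      by (metis Suc_less_eq lessThan_iff)
  qed
  moreover have "\<forall>j<m. R (i (\<sigma> j)) (b (\<sigma> j))"
    using R \<sigma> by blast
  ultimately show ?thesis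
    by blast
qed

section \<open>Ordered partitions as words\<close>

text \<open>
  This inverts the map that writes down, for each element, the number of its block. Elements and
  letters start at \<open>1\<close> but list positions at \<open>0\<close>, hence the two successors.
\<close>

definition blocks_of_word :: "nat \<Rightarrow> nat list \<Rightarrow> nat set list" where
  "blocks_of_word k w = map (\<lambda>i. {Suc a | a. a < length w \<and> w ! a = Suc i}) [0..<k]"

lemma length_blocks_of_word [simp]: "length (blocks_of_word k w) = k"
  by (simp add: blocks_of_word_def)

lemma in_nth_blocks_of_word_iff:
  "i < k \<Longrightarrow> x \<in> blocks_of_word k w ! i \<longleftrightarrow> (\<exists>a<length w. x = Suc a \<and> w ! a = Suc i)"
  by (auto simp: blocks_of_word_def)

lemma nth_in_letters:
  assumes "set w = {1..k}" and "a < length w"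
  obtains i where "i < k" "w ! a = Suc i"
proof -
  have "w ! a \<in> {1..k}"
    using assms nth_mem by blast
  then show thesis
    by (intro that[of "w ! a - 1"]) auto
qed

lemma blocks_of_word_in_ordered_partitions:
  assumes "set w = {1..k}"
  shows "blocks_of_word k w \<in> ordered_partitions (length w) k"
proof -
  have "blocks_of_word k w ! i \<noteq> {}" if "i < k" for i
  proof -
    have "Suc i \<in> set w"
      using assms that by auto
    then show ?thesis
      using in_nth_blocks_of_word_iff[OF that] by (auto simp: in_set_conv_nth)
  qed
  moreover have "disjoint_family_on (\<lambda>i. blocks_of_word k w ! i) {..<k}"
    by (auto simp: disjoint_family_on_def in_nth_blocks_of_word_iff)
  moreover have "\<Union> (set (blocks_of_word k w)) = {1..length w}"
  proof (intro equalityI subsetI)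
    fix x assume "x \<in> {1..length w}"
    then obtain a where a: "x = Suc a" "a < length w"
      by (cases x) auto
    moreover obtain i where i: "i < k" "w ! a = Suc i"
      using nth_in_letters[OF assms a(2)] .
    ultimately have "x \<in> blocks_of_word k w ! i"
      by (auto simp: in_nth_blocks_of_word_iff)
    then show "x \<in> \<Union> (set (blocks_of_word k w))"
      using i by (metis UnionI length_blocks_of_word nth_mem)
  qed (auto simp: blocks_of_word_def)
  ultimately show ?thesis
    unfolding ordered_partitions_def by (auto simp: in_set_conv_nth)
qed

lemma inj_on_blocks_of_word:
  "inj_on (blocks_of_word k) {w. length w = n \<and> set w = {1..k}}"
proof (rule inj_onI)
  fix w w' assume W: "w \<in> {w. length w = n \<and> set w = {1..k}}"
    "w' \<in> {w. length w = n \<and> set w = {1..k}}"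
    and eq: "blocks_of_word k w = blocks_of_word k w'"
  from W have w: "set w = {1..k}" and len: "length w = length w'"
    by auto
  show "w = w'"
  proof (rule nth_equalityI[OF len])
    fix a assume a: "a < length w"
    obtain i where i: "i < k" "w ! a = Suc i"
      using nth_in_letters[OF w a] .
    then have "Suc a \<in> blocks_of_word k w ! i"
      using a by (auto simp: in_nth_blocks_of_word_iff)
    then show "w ! a = w' ! a"
      using i unfolding eq by (auto simp: in_nth_blocks_of_word_iff)
  qed
qed

lemma ordered_partition_is_blocks_of_word:
  assumes "\<pi> \<in> ordered_partitions n k"
  shows "\<exists>w. length w = n \<and> set w = {1..k} \<and> blocks_of_word k w = \<pi>"
proof -
  have len: "length \<pi> = k" and ne: "\<And>B. B \<in> set \<pi> \<Longrightarrow> B \<noteq> {}"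
    and disj: "disjoint_family_on (\<lambda>i. \<pi> ! i) {..<k}" and un: "\<Union> (set \<pi>) = {1..n}"
    using assms by (auto simp: ordered_partitions_def)
  have "\<exists>i<k. Suc a \<in> \<pi> ! i" if "a < n" for a
  proof -
    have "Suc a \<in> \<Union> (set \<pi>)"
      unfolding un using that by auto
    then show ?thesis
      by (auto simp: in_set_conv_nth len)
  qed
  then obtain g where g: "\<And>a. a < n \<Longrightarrow> g a < k \<and> Suc a \<in> \<pi> ! g a"
    by metis
  have uniq: "g a = i" if "a < n" "i < k" "Suc a \<in> \<pi> ! i" for a i
    using disj g[OF that(1)] that by (auto simp: disjoint_family_on_def)
  have elem: "\<exists>a<n. x = Suc a" if "i < k" "x \<in> \<pi> ! i" for i x
  proof -
    have "x \<in> {1..n}"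
      using that un len by (metis UnionI nth_mem)
    then show ?thesis
      by (cases x) auto
  qed
  define w where "w = map (\<lambda>a. Suc (g a)) [0..<n]"
  have "blocks_of_word k w = \<pi>"
  proof (rule nth_equalityI)
    fix i assume "i < length (blocks_of_word k w)"
    then have i: "i < k"
      by simp
    show "blocks_of_word k w ! i = \<pi> ! i"
    proof (intro equalityI subsetI)
      fix x assume "x \<in> blocks_of_word k w ! i"
      then obtain a where "x = Suc a" "a < n" "g a = i"
        using i by (auto simp: in_nth_blocks_of_word_iff w_def)
      then show "x \<in> \<pi> ! i"
        using g by blast
    next
      fix x assume x: "x \<in> \<pi> ! i"
      then obtain a where "x = Suc a" "a < n"
        using elem[OF i] by blast
      moreover from this have "g a = i"
        using uniq i x by blast
      ultimately show "x \<in> blocks_of_word k w ! i"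
        using i by (simp add: in_nth_blocks_of_word_iff w_def)
    qed
  qed (simp add: len)
  moreover have "set w = {1..k}"
  proof (intro equalityI subsetI)
    fix x assume "x \<in> {1..k}"
    then obtain i where i: "x = Suc i" "i < k"
      by (cases x) auto
    then obtain y where "y \<in> \<pi> ! i"
      using ne len by (metis ex_in_conv nth_mem)
    then obtain a where "a < n" "Suc a \<in> \<pi> ! i"
      using elem i by blast
    then show "x \<in> set w"
      using uniq i by (force simp: w_def)
  qed (use g in \<open>auto simp: w_def Suc_le_eq\<close>)
  moreover have "length w = n"
    by (simp add: w_def)
  ultimately show ?thesis
    by blast
qed

lemma bij_betw_blocks_of_word:
  "bij_betw (blocks_of_word k) {w. length w = n \<and> set w = {1..k}} (ordered_partitions n k)"
proof -
  have "blocks_of_word k ` {w. length w = n \<and> set w = {1..k}} = ordered_partitions n k"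
    using blocks_of_word_in_ordered_partitions ordered_partition_is_blocks_of_word by fastforce
  then show ?thesis
    unfolding bij_betw_def using inj_on_blocks_of_word by blast
qed

text \<open>
  Both directions are the transposition of occurrences; subtracting or adding \<open>1\<close> passes between
  list positions and the elements and letters, which are positive.
\<close>

lemma partition_contains_blocks_of_word_iff:
  assumes p: "p permutes {1..m}" and w: "set w = {1..k}"
  shows "partition_contains (blocks_of_word k w) (one_line m p) \<longleftrightarrow>
         word_contains w (one_line m (inv p))"
proof
  assume "partition_contains (blocks_of_word k w) (one_line m p)"
  then obtain i b where i: "strict_mono_on {..<m} i"
    and b: "order_isomorphic (map b [0..<m]) (one_line m p)"
    and R: "\<forall>j<m. i j < k \<and> b j \<in> blocks_of_word k w ! i j"
    by (auto simp: partition_contains_def)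
  obtain c v where c: "strict_mono_on {..<m} c"
    and v: "order_isomorphic (map v [0..<m]) (one_line m (inv p))"
    and vc: "\<forall>j<m. v j < k \<and> c j \<in> blocks_of_word k w ! v j"
    using occurrence_transpose[OF p i b, of "\<lambda>x y. x < k \<and> y \<in> blocks_of_word k w ! x"] R
    by blast
  have pos: "0 < c j \<and> c j - 1 < length w \<and> w ! (c j - 1) = Suc (v j)" if "j < m" for j
  proof -
    have "v j < k" "c j \<in> blocks_of_word k w ! v j"
      using vc that by auto
    then show ?thesis
      by (auto simp: in_nth_blocks_of_word_iff)
  qed
  have "strict_mono_on {..<m} (\<lambda>j. c j - 1)"
  proof (rule strict_mono_onI)
    fix s t assume "s \<in> {..<m}" "t \<in> {..<m}" "s < t"
    then show "c s - 1 < c t - 1"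
      using strict_mono_onD[OF c, of s t] pos[of s] by auto
  qed
  moreover have "order_isomorphic (map (\<lambda>j. w ! (c j - 1)) [0..<m]) (one_line m (inv p))"
    using v pos by (auto simp: order_isomorphic_one_line_iff)
  ultimately show "word_contains w (one_line m (inv p))"
    using pos unfolding word_contains_def length_one_line
    by (intro exI[of _ "\<lambda>j. c j - 1"]) auto
next
  assume "word_contains w (one_line m (inv p))"
  then obtain a where a: "strict_mono_on {..<m} a"
    and b: "order_isomorphic (map (\<lambda>j. w ! a j) [0..<m]) (one_line m (inv p))"
    and R: "\<forall>j<m. a j < length w"
    by (auto simp: word_contains_def)
  obtain c v where c: "strict_mono_on {..<m} c"
    and v: "order_isomorphic (map v [0..<m]) (one_line m p)"
    and vc: "\<forall>j<m. v j < length w \<and> w ! v j = c j"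
    using occurrence_transpose[OF permutes_inv[OF p] a b, of "\<lambda>x y. x < length w \<and> w ! x = y"] R
      permutes_inv_inv[OF p] by auto
  have pos: "0 < c j \<and> c j - 1 < k \<and> Suc (v j) \<in> blocks_of_word k w ! (c j - 1)"
    if "j < m" for j
  proof -
    have vj: "v j < length w" "w ! v j = c j"
      using vc that by auto
    obtain i where "i < k" "w ! v j = Suc i"
      using nth_in_letters[OF w vj(1)] .
    then show ?thesis
      using vj by (auto simp: in_nth_blocks_of_word_iff)
  qed
  have "strict_mono_on {..<m} (\<lambda>j. c j - 1)"
  proof (rule strict_mono_onI)
    fix s t assume "s \<in> {..<m}" "t \<in> {..<m}" "s < t"
    then show "c s - 1 < c t - 1"
      using strict_mono_onD[OF c, of s t] pos[of s] by auto
  qed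
  moreover have "order_isomorphic (map (\<lambda>j. Suc (v j)) [0..<m]) (one_line m p)"
    using v by (simp add: order_isomorphic_one_line_iff)
  ultimately show "partition_contains (blocks_of_word k w) (one_line m p)"
    using pos unfolding partition_contains_def length_one_line
    by (intro exI[of _ "\<lambda>j. c j - 1"] exI[of _ "\<lambda>j. Suc (v j)"]) auto
qed

lemma op_count_eq_card_words:
  assumes "p permutes {1..m}"
  shows "op_count n k (one_line m p) =
         card {w. length w = n \<and> set w = {1..k} \<and> \<not> word_contains w (one_line m (inv p))}"
proof -
  let ?W = "{w. length w = n \<and> set w = {1..k}}"
  let ?V = "{w. length w = n \<and> set w = {1..k} \<and> \<not> word_contains w (one_line m (inv p))}"
  have "blocks_of_word k ` ?V =
      {\<pi> \<in> blocks_of_word k ` ?W. \<not> partition_contains \<pi> (one_line m p)}"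
    using partition_contains_blocks_of_word_iff[OF assms] by blast
  also have "\<dots> = {\<pi> \<in> ordered_partitions n k. \<not> partition_contains \<pi> (one_line m p)}"
    using bij_betw_imp_surj_on[OF bij_betw_blocks_of_word] by metis
  finally have "op_count n k (one_line m p) = card (blocks_of_word k ` ?V)"
    by (simp add: op_count_def)
  also have "\<dots> = card ?V"
    by (rule card_image, rule inj_on_subset[OF inj_on_blocks_of_word[of k n]]) auto
  finally show ?thesis .
qed

section \<open>Counting words by their set of letters\<close>

lemma word_contains_map_iff:
  assumes "strict_mono_on (set w) f"
  shows "word_contains (map f w) q \<longleftrightarrow> word_contains w q"
proof -
  have "order_isomorphic (map (\<lambda>j. map f w ! i j) [0..<length q]) q \<longleftrightarrow>
        order_isomorphic (map (\<lambda>j. w ! i j) [0..<length q]) q"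
    if "\<forall>j<length q. i j < length w" for i
    using that strict_mono_on_less[OF assms] by (auto simp: order_isomorphic_def)
  then show ?thesis
    unfolding word_contains_def by (metis length_map)
qed

text \<open>Relabelling along the increasing bijection from \<open>[card T]\<close> to \<open>T\<close> preserves avoidance.\<close>

lemma card_avoiding_words_over:
  fixes T :: "nat set"
  assumes "finite T"
  shows "card {w. length w = n \<and> set w \<subseteq> T \<and> \<not> word_contains w q} =
         card (avoiding_words (card T) n q)"
proof -
  obtain h where h: "bij_betw h {..<card T} T" "strict_mono_on {..<card T} h"
    using ex_bij_betw_strict_mono_card[OF assms] by blast
  define f where "f x = h (x - 1)" for x
  have f: "strict_mono_on {1..card T} f"
  proof (rule strict_mono_onI)
    fix x y assume "x \<in> {1..card T}" "y \<in> {1..card T}" "x < y"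
    then show "f x < f y"
      unfolding f_def by (intro strict_mono_onD[OF h(2)]) auto
  qed
  have fT: "f ` {1..card T} = T"
  proof -
    have "f ` {1..card T} = h ` (\<lambda>x. x - 1) ` {1..card T}"
      by (simp add: image_image f_def)
    also have "(\<lambda>x. x - 1) ` {1..card T} = {..<card T}"
      by (auto simp: image_iff intro!: bexI[of _ "Suc _"])
    finally show ?thesis
      using h(1) by (simp add: bij_betw_def)
  qed
  have "map f ` avoiding_words (card T) n q =
      {w. length w = n \<and> set w \<subseteq> T \<and> \<not> word_contains w q}" (is "?L = ?R")
  proof (intro equalityI subsetI)
    fix w assume "w \<in> ?L"
    then obtain u where u: "w = map f u" "length u = n" "set u \<subseteq> {1..card T}"
        "\<not> word_contains u q"
      by (auto simp: avoiding_words_def)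
    then show "w \<in> ?R"
      using fT word_contains_map_iff[OF monotone_on_subset[OF f]] by auto
  next
    fix w assume w: "w \<in> ?R"
    then have "w \<in> lists (f ` {1..card T})"
      using fT by auto
    then obtain u where u: "w = map f u" "set u \<subseteq> {1..card T}"
      unfolding lists_image by auto
    then have "u \<in> avoiding_words (card T) n q"
      using w word_contains_map_iff[OF monotone_on_subset[OF f]]
      by (auto simp: avoiding_words_def)
    with u show "w \<in> ?L"
      by blast
  qed
  moreover have "inj_on (map f) (avoiding_words (card T) n q)"
    by (rule inj_on_mapI, rule inj_on_subset[OF strict_mono_on_imp_inj_on[OF f]])
      (auto simp: avoiding_words_def)
  ultimately show ?thesis
    by (metis card_image)
qed

lemma sum_Pow_by_card:
  fixes h :: "nat \<Rightarrow> 'a::comm_semiring_1"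
  assumes "finite S"
  shows "(\<Sum>T\<in>Pow S. h (card T)) = (\<Sum>j\<le>card S. of_nat (card S choose j) * h j)"
proof -
  have "(\<Sum>T\<in>Pow S. h (card T)) = (\<Sum>j\<le>card S. \<Sum>T | T \<in> Pow S \<and> card T = j. h (card T))"
    using assms by (intro sum.group[symmetric]) (auto intro: card_mono)
  also have "\<dots> = (\<Sum>j\<le>card S. of_nat (card S choose j) * h j)"
  proof (rule sum.cong[OF refl])
    fix j
    have "(\<Sum>T | T \<in> Pow S \<and> card T = j. h (card T)) = (\<Sum>T | T \<subseteq> S \<and> card T = j. h j)"
      by (rule sum.cong) auto
    then show "(\<Sum>T | T \<in> Pow S \<and> card T = j. h (card T)) = of_nat (card S choose j) * h j"
      by (simp add: n_subsets[OF assms])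
  qed
  finally show ?thesis .
qed

lemma card_surjective_avoiding_words:
  "int (card {w. length w = n \<and> set w = {1..k} \<and> \<not> word_contains w q}) =
   (\<Sum>j\<le>k. int (k choose j) * ((-1) ^ (k - j) * int (card (avoiding_words j n q))))"
proof -
  let ?f = "\<lambda>A. int (card {w. length w = n \<and> set w = A \<and> \<not> word_contains w q})"
  let ?g = "\<lambda>A. int (card {w. length w = n \<and> set w \<subseteq> A \<and> \<not> word_contains w q})"
  have "?g S = sum ?f (Pow S)" if S: "finite S" for S
  proof -
    have fin: "finite {w. length w = n \<and> set w = T \<and> \<not> word_contains w q}" if "T \<subseteq> S" for T
      by (rule finite_subset[OF _ finite_lists_length_eq[OF S, of n]]) (use that in auto)
    have "{w. length w = n \<and> set w \<subseteq> S \<and> \<not> word_contains w q} =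
        (\<Union>T\<in>Pow S. {w. length w = n \<and> set w = T \<and> \<not> word_contains w q})"
      by auto
    also have "card \<dots> =
        (\<Sum>T\<in>Pow S. card {w. length w = n \<and> set w = T \<and> \<not> word_contains w q})"
      by (rule card_UN_disjoint) (use S fin in auto)
    finally show ?thesis
      by simp
  qed
  then have "?f {1..k} = (\<Sum>T\<in>Pow {1..k}. (-1) ^ (card {1..k} - card T) * ?g T)"
    by (rule inclusion_exclusion_mobius) auto
  also have "\<dots> = (\<Sum>T\<in>Pow {1..k}.
      (-1) ^ (k - card T) * int (card (avoiding_words (card T) n q)))"
  proof (rule sum.cong[OF refl])
    fix T assume "T \<in> Pow {1..k}"
    then have "finite T"
      by (auto intro: finite_subset)
    then show "(-1) ^ (card {1..k} - card T) * ?g T =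
        (-1) ^ (k - card T) * int (card (avoiding_words (card T) n q))"
      by (simp add: card_avoiding_words_over)
  qed
  also have "\<dots> =
      (\<Sum>j\<le>k. int (k choose j) * ((-1) ^ (k - j) * int (card (avoiding_words j n q))))"
    using sum_Pow_by_card[of "{1..k}"
        "\<lambda>j. (-1) ^ (k - j) * int (card (avoiding_words j n q))"] by simp
  finally show ?thesis .
qed

theorem proposition1p1:
  fixes p :: "nat \<Rightarrow> nat" and m n k :: nat
  assumes "m \<ge> 1" and "p permutes {1..m}"
    and "1 \<le> k" and "k \<le> n"
  shows "int (op_count n k (one_line m p)) =
    (\<Sum>j=1..k. int (k choose j) * (-1) ^ (k - j) *
       int (card (avoiding_words j n (one_line m (inv p)))))"
proof -
  let ?q = "one_line m (inv p)"
  let ?t = "\<lambda>j. int (k choose j) * ((-1) ^ (k - j) * int (card (avoiding_words j n ?q)))"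
  \<comment> \<open>No nonempty word has an empty alphabet, so the sum may start at \<open>1\<close>.\<close>
  have "avoiding_words 0 n ?q = {}"
    using assms(3,4) by (auto simp: avoiding_words_def)
  then have "?t 0 = 0"
    by simp
  then have "sum ?t {..k} = sum ?t {1..k}"
    by (intro sum.mono_neutral_right) (auto simp: not_less_eq_eq)
  then show ?thesis
    using op_count_eq_card_words[OF assms(2)] card_surjective_avoiding_words[of n k ?q]
    by (simp add: mult.assoc)
qed

end
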